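(* Let $\mathcal H$ be a separable complex Hilbert space and let $\boldsymbol T=(T_1,\dots,T_n)$ be a left-inverse commuting $n$-tuple of bounded linear operators on $\mathcal H$ such that, for each $1\le i\le n$, $T_i$ admits a Wold-type decomposition. For each $\boldsymbol\alpha\in\{0,1\}^n$ put $$\mathcal H_{\boldsymbol\alpha}=\bigvee_{\boldsymbol m\in\mathbb Z_+^n}\boldsymbol T^{\boldsymbol\alpha\circ\boldsymbol m}\Big(\bigcap_{\boldsymbol m\in\mathbb Z_+^n}\boldsymbol T^{\hat{\boldsymbol\alpha}\circ\boldsymbol m}\,\mathcal E_{\boldsymbol\alpha}\Big).$$ Then $\mathcal H$ is the orthogonal direct sum $\mathcal H=\bigoplus_{\boldsymbol\alpha\in\{0,1\}^n}\mathcal H_{\boldsymbol\alpha}$, where for each $\boldsymbol\alpha\in\{0,1\}^n$ the subspace $\mathcal H_{\boldsymbol\alpha}$ is reducing for every $T_1,\dots,T_n$, and $T_i|_{\mathcal H_{\boldsymbol\alpha}}$ is unitary whenever $\alpha_i=0$.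
   Context: $\bigvee$ denotes closed linear span; $\mathbb Z_+=\{0,1,2,\dots\}$. A closed subspace is $T$-reducing if it is invariant under both $T$ and $T^*$. For a bounded operator $T$, $\mathcal H_\infty(T)=\bigcap_{m\ge1}T^m\mathcal H$. A left invertible operator $T$ on $\mathcal H$ admits a Wold-type decomposition if $\mathcal H=\mathcal H_\infty(T)\oplus\bigvee_{m\ge0}T^m(\ker T^* )$ (orthogonal direct sum), $\mathcal H_\infty(T)$ is $T$-reducing, and $T|_{\mathcal H_\infty(T)}$ is unitary. A tuple $(T_1,\dots,T_n)$ of left invertible, pairwise commuting operators is left-inverse commuting if $L_iT_j=T_jL_i$ for all $1\le i\ne j\le n$, where $L_i=(T_i^*T_i)^{-1}T_i^*$. For $\boldsymbol m=(m_1,\dots,m_n)\in\mathbb Z_+^n$, $\boldsymbol T^{\boldsymbol m}=T_1^{m_1}\cdots T_n^{m_n}$, with $S^0=I$. For $\boldsymbol\alpha\in\{0,1\}^n$: $\hat{\boldsymbol\alpha}=(1-\alpha_1,\dots,1-\alpha_n)$; $\boldsymbol\alpha\circ\boldsymbol m=(\alpha_1m_1,\dots,\alpha_nm_n)$; and $\mathcal E_{\boldsymbol\alpha}=\{x\in\mathcal H: x\in\ker T_i^*\text{ whenever }\alpha_i=1\}$, so that $\mathcal E_{\boldsymbol 0}=\mathcal H$. *)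

theory Defs
  imports "HOL-Analysis.Analysis"
begin

section \<open>Complex Hilbert spaces\<close>

text \<open>
  A complex inner product space carries its underlying real inner product space structure,
  so the norm and the topology are the ones of \<^class>\<open>real_inner\<close>. The inner product
  \<open>cinner\<close> is linear in the first and conjugate linear in the second argument.
\<close>

class complex_inner = real_inner +
  fixes scaleC :: "complex \<Rightarrow> 'a \<Rightarrow> 'a" (infixr "*\<^sub>C" 75)
    and cinner :: "'a \<Rightarrow> 'a \<Rightarrow> complex"
  assumes scaleC_add_right: "a *\<^sub>C (x + y) = a *\<^sub>C x + a *\<^sub>C y"
    and scaleC_add_left: "(a + b) *\<^sub>C x = a *\<^sub>C x + b *\<^sub>C x"
    and scaleC_scaleC: "a *\<^sub>C b *\<^sub>C x = (a * b) *\<^sub>C x"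
    and scaleR_scaleC: "scaleR r x = complex_of_real r *\<^sub>C x"
    and cinner_commute: "cinner x y = cnj (cinner y x)"
    and cinner_add_left: "cinner (x + y) z = cinner x z + cinner y z"
    and cinner_scaleC_left: "cinner (a *\<^sub>C x) y = a * cinner x y"
    and inner_eq_Re_cinner: "inner x y = Re (cinner x y)"

class chilbert_space = complex_inner + complete_space

lemma vector_space_scaleC:
  "vector_space (scaleC :: complex \<Rightarrow> 'a \<Rightarrow> 'a::complex_inner)"
proof
  show "1 *\<^sub>C x = x" for x :: 'a
    using scaleR_scaleC[of 1 x] by simp
qed (simp_all add: scaleC_add_right scaleC_add_left scaleC_scaleC)

global_interpretation complex_vector:
  vector_space "scaleC :: complex \<Rightarrow> 'a \<Rightarrow> 'a::complex_inner"
  defines csubspace = complex_vector.subspace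
    and cspan = complex_vector.span
  by (rule vector_space_scaleC)

definition closed_csubspace :: "'a::complex_inner set \<Rightarrow> bool" where
  "closed_csubspace M \<longleftrightarrow> csubspace M \<and> closed M"

definition closed_cspan :: "'a::complex_inner set \<Rightarrow> 'a set" where
  "closed_cspan S = closure (cspan S)"

text \<open>
  Internal orthogonal direct sum of a family of closed subspaces over a finite index set;
  finiteness makes the finite sums below exhaust the Hilbert space direct sum.
\<close>

definition orthogonal_direct_sum :: "'i set \<Rightarrow> ('i \<Rightarrow> 'a::complex_inner set) \<Rightarrow> bool" where
  "orthogonal_direct_sum I M \<longleftrightarrow>
     finite I \<and>
     (\<forall>i\<in>I. closed_csubspace (M i)) \<and>
     (\<forall>i\<in>I. \<forall>j\<in>I. i \<noteq> j \<longrightarrow> (\<forall>x\<in>M i. \<forall>y\<in>M j. cinner x y = 0)) \<and>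
     (\<forall>x. \<exists>u. (\<forall>i\<in>I. u i \<in> M i) \<and> x = (\<Sum>i\<in>I. u i))"


section \<open>Operators\<close>

definition bounded_clinear :: "('a::complex_inner \<Rightarrow> 'a) \<Rightarrow> bool" where
  "bounded_clinear T \<longleftrightarrow> bounded_linear T \<and> (\<forall>c x. T (c *\<^sub>C x) = c *\<^sub>C T x)"

definition cadjoint :: "('a::complex_inner \<Rightarrow> 'a) \<Rightarrow> 'a \<Rightarrow> 'a" where
  "cadjoint T = (THE S. \<forall>x y. cinner (T x) y = cinner x (S y))"

definition left_invertible :: "('a::complex_inner \<Rightarrow> 'a) \<Rightarrow> bool" where
  "left_invertible T \<longleftrightarrow> (\<exists>S. bounded_clinear S \<and> S \<circ> T = id)"

definition reducing :: "('a::complex_inner \<Rightarrow> 'a) \<Rightarrow> 'a set \<Rightarrow> bool" where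
  "reducing T M \<longleftrightarrow> closed_csubspace M \<and> T ` M \<subseteq> M \<and> cadjoint T ` M \<subseteq> M"

text \<open>
  The restriction of \<open>T\<close> to \<open>M\<close> is unitary: it is an operator on \<open>M\<close> whose adjoint
  \<open>S\<close>, taken in \<open>M\<close>, is its two-sided inverse.
\<close>

definition unitary_on :: "'a::complex_inner set \<Rightarrow> ('a \<Rightarrow> 'a) \<Rightarrow> bool" where
  "unitary_on M T \<longleftrightarrow>
     T ` M \<subseteq> M \<and>
     (\<exists>S. S ` M \<subseteq> M \<and>
          (\<forall>x\<in>M. \<forall>y\<in>M. cinner (T x) y = cinner x (S y)) \<and>
          (\<forall>x\<in>M. S (T x) = x \<and> T (S x) = x))"

definition H_infinity :: "('a::complex_inner \<Rightarrow> 'a) \<Rightarrow> 'a set" where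
  "H_infinity T = (\<Inter>m\<in>{1..}. range (T ^^ m))"

text \<open>The index \<open>True\<close> stands for the first and \<open>False\<close> for the second summand.\<close>

definition wold_type_decomposition :: "('a::complex_inner \<Rightarrow> 'a) \<Rightarrow> bool" where
  "wold_type_decomposition T \<longleftrightarrow>
     orthogonal_direct_sum UNIV
       (\<lambda>b. if b then H_infinity T
            else closed_cspan (\<Union>m. (T ^^ m) ` {x. cadjoint T x = 0})) \<and>
     reducing T (H_infinity T) \<and>
     unitary_on (H_infinity T) T"


section \<open>Tuples of operators\<close>

text \<open>
  An \<open>n\<close>-tuple is a function on \<open>nat\<close> of which only the values on \<open>{1..n}\<close> are used.
  For left invertible \<open>T\<close> the operator \<open>T\<^sup>* T\<close> is bijective, so \<open>inv\<close> is its actual inverse.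
\<close>

definition canonical_left_inverse :: "('a::complex_inner \<Rightarrow> 'a) \<Rightarrow> 'a \<Rightarrow> 'a" where
  "canonical_left_inverse T = inv (cadjoint T \<circ> T) \<circ> cadjoint T"

definition left_inverse_commuting :: "nat \<Rightarrow> (nat \<Rightarrow> 'a::complex_inner \<Rightarrow> 'a) \<Rightarrow> bool" where
  "left_inverse_commuting n T \<longleftrightarrow>
     (\<forall>i\<in>{1..n}. bounded_clinear (T i) \<and> left_invertible (T i)) \<and>
     (\<forall>i\<in>{1..n}. \<forall>j\<in>{1..n}. T i \<circ> T j = T j \<circ> T i) \<and>
     (\<forall>i\<in>{1..n}. \<forall>j\<in>{1..n}. i \<noteq> j \<longrightarrow>
        canonical_left_inverse (T i) \<circ> T j = T j \<circ> canonical_left_inverse (T i))"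

definition multi_indices :: "nat \<Rightarrow> (nat \<Rightarrow> nat) set" where
  "multi_indices n = {1..n} \<rightarrow>\<^sub>E UNIV"

definition binary_indices :: "nat \<Rightarrow> (nat \<Rightarrow> nat) set" where
  "binary_indices n = {1..n} \<rightarrow>\<^sub>E {0, 1}"

definition index_complement :: "(nat \<Rightarrow> nat) \<Rightarrow> nat \<Rightarrow> nat" where
  "index_complement \<alpha> = (\<lambda>i. 1 - \<alpha> i)"

definition index_mult :: "(nat \<Rightarrow> nat) \<Rightarrow> (nat \<Rightarrow> nat) \<Rightarrow> nat \<Rightarrow> nat" where
  "index_mult \<alpha> m = (\<lambda>i. \<alpha> i * m i)"

text \<open>\<open>T\<^sub>1\<close> is the outermost factor: the composition is \<open>T\<^sub>1 ^^ m\<^sub>1 \<circ> \<dots> \<circ> T\<^sub>n ^^ m\<^sub>n\<close>.\<close>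

definition multi_power :: "nat \<Rightarrow> (nat \<Rightarrow> 'a \<Rightarrow> 'a) \<Rightarrow> (nat \<Rightarrow> nat) \<Rightarrow> 'a \<Rightarrow> 'a" where
  "multi_power n T m = foldr (\<lambda>i f. (T i ^^ m i) \<circ> f) [1..<Suc n] id"

definition wandering_space ::
    "nat \<Rightarrow> (nat \<Rightarrow> 'a::complex_inner \<Rightarrow> 'a) \<Rightarrow> (nat \<Rightarrow> nat) \<Rightarrow> 'a set" where
  "wandering_space n T \<alpha> = {x. \<forall>i\<in>{1..n}. \<alpha> i = 1 \<longrightarrow> cadjoint (T i) x = 0}"

definition wold_component ::
    "nat \<Rightarrow> (nat \<Rightarrow> 'a::complex_inner \<Rightarrow> 'a) \<Rightarrow> (nat \<Rightarrow> nat) \<Rightarrow> 'a set" where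
  "wold_component n T \<alpha> =
     closed_cspan (\<Union>m\<in>multi_indices n. multi_power n T (index_mult \<alpha> m) `
       (\<Inter>k\<in>multi_indices n.
          multi_power n T (index_mult (index_complement \<alpha>) k) ` wandering_space n T \<alpha>))"

end

theory Submission
  imports Defs
begin

text \<open>
  Left-inverse commutation makes \<open>ker T\<^sub>j\<^sup>*\<close> and, with the Wold-type decomposition, both
  \<open>H\<^sub>\<infinity>(T\<^sub>j)\<close> and its orthogonal complement reducing for every \<open>T\<^sub>i\<close> with \<open>i \<noteq> j\<close>. Hence the
  orthogonal projections onto the \<open>H\<^sub>\<infinity>(T\<^sub>j)\<close> commute with each other and with all the operators,
  and \<open>H\<close> splits into the \<open>2\<^sup>n\<close> joint summands, one for each choice of \<open>H\<^sub>\<infinity>(T\<^sub>j)\<close> (if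
  \<open>\<alpha>\<^sub>j = 0\<close>) or its complement (if \<open>\<alpha>\<^sub>j = 1\<close>). A joint summand is identified with
  \<open>H\<^sub>\<alpha>\<close> by peeling off one index with \<open>\<alpha>\<^sub>i = 1\<close> at a time: if \<open>K\<close> reduces \<open>T\<close>, then the part
  of \<open>K\<close> orthogonal to \<open>H\<^sub>\<infinity>(T)\<close> is generated by \<open>K \<inter> ker T\<^sup>*\<close>.
\<close>

section \<open>Complex inner product spaces\<close>

lemma cinner_add_right: "cinner x (y + z) = cinner x y + cinner x z"
  for x :: "'a::complex_inner"
  by (metis cinner_add_left cinner_commute complex_cnj_add)

lemma cinner_scaleC_right: "cinner x (c *\<^sub>C y) = cnj c * cinner x y"
  for x :: "'a::complex_inner"
  by (metis cinner_commute cinner_scaleC_left complex_cnj_mult)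

lemma cinner_zero_left [simp]: "cinner 0 x = 0" for x :: "'a::complex_inner"
  using cinner_add_left[of 0 0 x] by simp

lemma cinner_zero_right [simp]: "cinner x 0 = 0" for x :: "'a::complex_inner"
  using cinner_add_right[of x 0 0] by simp

lemma cinner_diff_left: "cinner (x - y) z = cinner x z - cinner y z"
  for x :: "'a::complex_inner"
  using cinner_add_left[of "x - y" y z] by simp

lemma cinner_diff_right: "cinner x (y - z) = cinner x y - cinner x z"
  for x :: "'a::complex_inner"
  using cinner_add_right[of x "y - z" z] by simp

lemma cinner_self_eq_0_iff [simp]: "cinner x x = 0 \<longleftrightarrow> x = 0" for x :: "'a::complex_inner"
  using inner_eq_Re_cinner[of x x] by auto

lemma cinner_eq_0_commute: "cinner x y = 0 \<longleftrightarrow> cinner y x = 0" for x :: "'a::complex_inner"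
  by (metis cinner_commute complex_cnj_zero)

text \<open>The imaginary part is again a real inner product, taken with
  \<open>\<i> *\<^sub>C y\<close>. Facts about \<open>inner\<close>, such as continuity and the
  Riesz representation, pass to \<open>cinner\<close> this way.\<close>

lemma cinner_conv_inner: "cinner x y = Complex (inner x y) (inner x (\<i> *\<^sub>C y))"
  for x :: "'a::complex_inner"
  by (simp add: complex_eq_iff inner_eq_Re_cinner cinner_scaleC_right)

lemma cinner_ext:
  fixes x y :: "'a::complex_inner"
  assumes "\<And>z. cinner z x = cinner z y"
  shows "x = y"
proof -
  have "cinner (x - y) (x - y) = 0"
    by (simp add: assms cinner_diff_right)
  then show ?thesis
    by simp
qed

lemma norm_scaleC: "norm (c *\<^sub>C x) = cmod c * norm x" for x :: "'a::complex_inner"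
proof -
  have "(norm (c *\<^sub>C x))\<^sup>2 = Re (c * cnj c * cinner x x)"
    by (simp only: power2_norm_eq_inner inner_eq_Re_cinner cinner_scaleC_left
        cinner_scaleC_right mult_ac)
  also have "\<dots> = (cmod c)\<^sup>2 * (norm x)\<^sup>2"
    by (simp add: complex_norm_square[symmetric] power2_norm_eq_inner inner_eq_Re_cinner
        flip: of_real_power)
  finally show ?thesis
    by (metis norm_ge_zero power2_eq_imp_eq power_mult_distrib zero_le_mult_iff)
qed

lemma bounded_linear_scaleC: "bounded_linear ((*\<^sub>C) c :: 'a \<Rightarrow> 'a::complex_inner)"
  by (rule bounded_linear_intro[where K = "cmod c"])
    (simp_all add: scaleC_add_right scaleR_scaleC scaleC_scaleC mult.commute norm_scaleC)

section \<open>Orthogonal complements and closed linear spans\<close>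

definition orth :: "'a::complex_inner set \<Rightarrow> 'a set" where
  "orth S = {x. \<forall>y\<in>S. cinner x y = 0}"

text \<open>Each defining condition is the vanishing of two real inner products, so closedness
  follows from continuity of \<open>inner\<close>.\<close>

lemma closed_csubspace_orth: "closed_csubspace (orth S)"
proof -
  have "orth S = (\<Inter>y\<in>S. {x. inner x y = 0} \<inter> {x. inner x (\<i> *\<^sub>C y) = 0})"
    by (auto simp: orth_def cinner_conv_inner complex_eq_iff)
  moreover have "closed \<dots>"
    by (intro closed_INT closed_Int closed_Collect_eq ballI continuous_intros)
  moreover have "csubspace (orth S)"
    by (auto simp: complex_vector.subspace_def orth_def cinner_add_left cinner_scaleC_left)
  ultimately show ?thesis
    by (simp add: closed_csubspace_def)
qed

lemma closed_csubspace_Int: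
  "closed_csubspace M \<Longrightarrow> closed_csubspace N \<Longrightarrow> closed_csubspace (M \<inter> N)"
  by (simp add: closed_csubspace_def complex_vector.subspace_inter closed_Int)

lemma closed_csubspace_INT:
  "(\<And>i. i \<in> I \<Longrightarrow> closed_csubspace (M i)) \<Longrightarrow> closed_csubspace (\<Inter>i\<in>I. M i)"
  by (auto simp: closed_csubspace_def complex_vector.subspace_def intro!: closed_INT)

lemma closed_csubspace_diff: "closed_csubspace M \<Longrightarrow> x \<in> M \<Longrightarrow> y \<in> M \<Longrightarrow> x - y \<in> M"
  by (simp add: closed_csubspace_def complex_vector.subspace_diff)

lemma csubspace_closure:
  fixes M :: "'a::complex_inner set"
  assumes "csubspace M"
  shows "csubspace (closure M)"
  unfolding complex_vector.subspace_def
proof (intro conjI ballI allI)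
  show "0 \<in> closure M"
    using assms closure_subset by (auto simp: complex_vector.subspace_def)
next
  fix x y assume "x \<in> closure M" "y \<in> closure M"
  then obtain f g where "\<forall>n. f n \<in> M" "f \<longlonglongrightarrow> x" "\<forall>n. g n \<in> M" "g \<longlonglongrightarrow> y"
    unfolding closure_sequential by blast
  then show "x + y \<in> closure M"
    unfolding closure_sequential using assms
    by (intro exI[of _ "\<lambda>n. f n + g n"]) (auto simp: complex_vector.subspace_def intro: tendsto_add)
next
  fix c x assume "x \<in> closure M"
  moreover have "(*\<^sub>C) c ` closure M \<subseteq> closure ((*\<^sub>C) c ` M)"
    by (rule closure_bounded_linear_image_subset[OF bounded_linear_scaleC])
  moreover have "closure ((*\<^sub>C) c ` M) \<subseteq> closure M"
    using assms by (intro closure_mono) (auto simp: complex_vector.subspace_def)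
  ultimately show "c *\<^sub>C x \<in> closure M"
    by blast
qed

lemma closed_csubspace_closed_cspan: "closed_csubspace (closed_cspan S)"
  by (simp add: closed_csubspace_def closed_cspan_def csubspace_closure)

lemma closed_cspan_superset: "S \<subseteq> closed_cspan S"
  unfolding closed_cspan_def
  using closure_subset complex_vector.span_superset by blast

lemma closed_cspan_minimal: "S \<subseteq> M \<Longrightarrow> closed_csubspace M \<Longrightarrow> closed_cspan S \<subseteq> M"
  unfolding closed_cspan_def closed_csubspace_def
  by (simp add: closure_minimal complex_vector.span_minimal)

lemma closed_cspan_mono: "S \<subseteq> S' \<Longrightarrow> closed_cspan S \<subseteq> closed_cspan S'"
  by (meson closed_cspan_minimal closed_cspan_superset closed_csubspace_closed_cspan order_trans)

lemma subspace_if_closed_csubspace: "closed_csubspace M \<Longrightarrow> subspace M"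
  by (simp add: closed_csubspace_def complex_vector.subspace_def subspace_def scaleR_scaleC)

section \<open>Orthogonal projections and adjoints\<close>

text \<open>A minimizing sequence is Cauchy by the parallelogram law, because midpoints of its
  members stay in \<open>M\<close>; its limit attains the infimum.\<close>

lemma closed_subspace_minimizer:
  fixes M :: "'a::{real_inner, complete_space} set"
  assumes "subspace M" "closed M"
  obtains y where "y \<in> M" "\<And>z. z \<in> M \<Longrightarrow> norm (x - y) \<le> norm (x - z)"
proof -
  define d where "d = (INF z\<in>M. (norm (x - z))\<^sup>2)"
  have bdd: "bdd_below ((\<lambda>z. (norm (x - z))\<^sup>2) ` M)"
    by (rule bdd_belowI2[of _ 0]) simp
  have d_le: "d \<le> (norm (x - z))\<^sup>2" if "z \<in> M" for z
    unfolding d_def using bdd that by (rule cINF_lower)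
  have ne: "M \<noteq> {}"
    using subspace_0[OF assms(1)] by blast
  have "\<exists>z\<in>M. (norm (x - z))\<^sup>2 < d + inverse (real (Suc k))" for k
  proof -
    have "(INF z\<in>M. (norm (x - z))\<^sup>2) < d + inverse (real (Suc k))"
      by (simp add: d_def)
    then show ?thesis
      using cINF_less_iff[OF ne bdd] by blast
  qed
  then obtain f where f: "\<And>k. f k \<in> M" "\<And>k. (norm (x - f k))\<^sup>2 < d + inverse (real (Suc k))"
    by metis
  have close: "(dist (f j) (f k))\<^sup>2 < 2 * inverse (real (Suc j)) + 2 * inverse (real (Suc k))" for j k
  proof -
    have "(1 / 2) *\<^sub>R (f j + f k) \<in> M"
      by (intro subspace_scale subspace_add assms f)
    then have "d \<le> (norm (x - (1 / 2) *\<^sub>R (f j + f k)))\<^sup>2"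
      by (rule d_le)
    \<comment> \<open>Parallelogram law for \<open>x - f j\<close> and \<open>x - f k\<close>; their
      half sum is \<open>x\<close> minus the midpoint.\<close>
    moreover have "(dist (f j) (f k))\<^sup>2 = 2 * (norm (x - f j))\<^sup>2 + 2 * (norm (x - f k))\<^sup>2
        - 4 * (norm (x - (1 / 2) *\<^sub>R (f j + f k)))\<^sup>2"
      unfolding dist_norm power2_norm_eq_inner
      by (simp add: inner_diff_left inner_diff_right inner_add_left inner_add_right
          inner_commute algebra_simps)
    ultimately show ?thesis
      using f(2)[of j] f(2)[of k] by linarith
  qed
  have "Cauchy f"
  proof (rule metric_CauchyI)
    fix e :: real assume "0 < e"
    then obtain N where N: "inverse (real (Suc N)) < e\<^sup>2 / 4"
      using reals_Archimedean[of "e\<^sup>2 / 4"] by auto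
    have "dist (f j) (f k) < e" if "N \<le> j" "N \<le> k" for j k
    proof (rule power_less_imp_less_base)
      have "inverse (real (Suc j)) \<le> inverse (real (Suc N))"
        "inverse (real (Suc k)) \<le> inverse (real (Suc N))"
        using that by (simp_all add: le_imp_inverse_le)
      then show "(dist (f j) (f k))\<^sup>2 < e\<^sup>2"
        using close[of j k] N by linarith
    qed (use \<open>0 < e\<close> in simp)
    then show "\<exists>N. \<forall>j\<ge>N. \<forall>k\<ge>N. dist (f j) (f k) < e"
      by blast
  qed
  then obtain y where y: "f \<longlonglongrightarrow> y"
    by (auto simp: Cauchy_convergent_iff convergent_def)
  have "(norm (x - y))\<^sup>2 \<le> d"
  proof (rule LIMSEQ_le)
    show "(\<lambda>k. (norm (x - f k))\<^sup>2) \<longlonglongrightarrow> (norm (x - y))\<^sup>2"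
      by (intro tendsto_intros y)
    show "(\<lambda>k. d + inverse (real (Suc k))) \<longlonglongrightarrow> d"
      using tendsto_add[OF tendsto_const LIMSEQ_inverse_real_of_nat] by fastforce
    show "\<exists>N. \<forall>k\<ge>N. (norm (x - f k))\<^sup>2 \<le> d + inverse (real (Suc k))"
      using f(2) less_imp_le by blast
  qed
  show ?thesis
  proof
    show "y \<in> M"
      using closed_sequentially[OF assms(2)] f(1) y by blast
    show "norm (x - y) \<le> norm (x - z)" if "z \<in> M" for z
      using \<open>(norm (x - y))\<^sup>2 \<le> d\<close> d_le[OF that]
      by (meson norm_ge_zero order_trans power2_le_imp_le)
  qed
qed

text \<open>The residual \<open>x - y\<close> of a nearest point \<open>y\<close> is orthogonal to
  \<open>M\<close>: otherwise moving \<open>y\<close> along some \<open>z\<close> in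
  \<open>M\<close> would shorten it.\<close>

lemma closed_subspace_decomposition:
  fixes M :: "'a::{real_inner, complete_space} set"
  assumes "subspace M" "closed M"
  obtains y where "y \<in> M" "\<And>z. z \<in> M \<Longrightarrow> inner (x - y) z = 0"
proof -
  obtain y where y: "y \<in> M" "\<And>z. z \<in> M \<Longrightarrow> norm (x - y) \<le> norm (x - z)"
    using closed_subspace_minimizer[OF assms] by metis
  have "inner (x - y) z = 0" if z: "z \<in> M" for z
  proof (cases "z = 0")
    case False
    \<comment> \<open>This value minimizes the squared norm of \<open>x - y - t *\<^sub>R z\<close>
      as a quadratic function of \<open>t\<close>.\<close>
    define t where "t = inner (x - y) z / inner z z"
    have "norm (x - y) \<le> norm (x - (y + t *\<^sub>R z))"
      by (intro y(2) subspace_add subspace_scale assms(1) y(1) z)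
    then have "inner (x - y) (x - y) \<le> inner ((x - y) - t *\<^sub>R z) ((x - y) - t *\<^sub>R z)"
      by (simp add: norm_le diff_diff_eq)
    also have "\<dots> = inner (x - y) (x - y) - 2 * t * inner (x - y) z + t * (t * inner z z)"
      by (simp only: inner_diff_left[of "x - y"] inner_diff_right[of _ "x - y"] inner_scaleR_left
          inner_scaleR_right inner_commute[of z "x - y"]) (simp add: algebra_simps)
    also have "t * inner z z = inner (x - y) z"
      using False by (simp add: t_def)
    finally have "t * inner (x - y) z \<le> 0"
      by simp
    then have "(inner (x - y) z)\<^sup>2 / inner z z \<le> 0"
      by (simp add: t_def power2_eq_square)
    then show ?thesis
      using False by (simp add: divide_le_0_iff) (metis inner_gt_zero_iff not_less)
  qed simp
  with y(1) that show ?thesis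
    by blast
qed

text \<open>The real decomposition suffices: \<open>M\<close> is closed under multiplication by
  \<i>, so a vector orthogonal to \<open>M\<close> for \<open>inner\<close> is orthogonal for
  \<open>cinner\<close>.\<close>

lemma orth_decomposition:
  fixes M :: "'a::chilbert_space set"
  assumes "closed_csubspace M"
  obtains y z where "y \<in> M" "z \<in> orth M" "x = y + z"
proof -
  obtain y where y: "y \<in> M" "\<And>z. z \<in> M \<Longrightarrow> inner (x - y) z = 0"
    using closed_subspace_decomposition[OF subspace_if_closed_csubspace[OF assms], of x] assms
    unfolding closed_csubspace_def by metis
  have "\<i> *\<^sub>C z \<in> M" if "z \<in> M" for z
    using assms that by (simp add: closed_csubspace_def complex_vector.subspace_scale)
  with y have "x - y \<in> orth M"
    by (simp add: orth_def cinner_conv_inner complex_eq_iff)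
  with y(1) that[of y "x - y"] show ?thesis
    by simp
qed

text \<open>The kernel of a nonzero \<open>f\<close> is a closed hyperplane; a suitable multiple of
  a nonzero vector \<open>v\<close> orthogonal to it represents \<open>f\<close>.\<close>

lemma riesz_representation:
  fixes f :: "'a::{real_inner, complete_space} \<Rightarrow> real"
  assumes "bounded_linear f"
  obtains w where "\<And>x. f x = inner x w"
proof (cases "\<forall>x. f x = 0")
  case True
  then show ?thesis
    using that[of 0] by simp
next
  case False
  interpret f: bounded_linear f
    by (rule assms)
  from False obtain x where x: "f x \<noteq> 0"
    by blast
  have "subspace {x. f x = 0}"
    by (auto simp: subspace_def f.add f.scaleR)
  moreover have "closed {x. f x = 0}"
    by (intro closed_Collect_eq continuous_intros f.continuous_on)
  ultimately obtain y where y: "f y = 0" "\<And>z. f z = 0 \<Longrightarrow> inner (x - y) z = 0"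
    using closed_subspace_decomposition[of "{x. f x = 0}" x] by auto
  define v where "v = x - y"
  have v: "f v \<noteq> 0" "inner v v \<noteq> 0"
    using x y(1) f.zero by (auto simp: v_def f.diff)
  show ?thesis
  proof (rule that)
    fix u
    have "inner v (u - (f u / f v) *\<^sub>R v) = 0"
      unfolding v_def using v(1) by (intro y(2)) (simp add: f.diff f.scaleR v_def)
    then have "inner v u = f u / f v * inner v v"
      by (simp add: inner_diff_right)
    then show "f u = inner u ((f v / inner v v) *\<^sub>R v)"
      using v by (simp add: inner_commute)
  qed
qed

section \<open>Adjoints, reducing subspaces and left inverses of a single operator\<close>

lemma funpow_image_subset: "T ` X \<subseteq> X \<Longrightarrow> x \<in> X \<Longrightarrow> (T ^^ m) x \<in> X"
  by (induction m) auto

lemma reducing_Int: "reducing T M \<Longrightarrow> reducing T N \<Longrightarrow> reducing T (M \<inter> N)"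
  by (auto simp: reducing_def closed_csubspace_Int)

lemma reducing_INT: "(\<And>i. i \<in> I \<Longrightarrow> reducing T (M i)) \<Longrightarrow> reducing T (\<Inter>i\<in>I. M i)"
  unfolding reducing_def by (fastforce intro!: closed_csubspace_INT)

context
  fixes T :: "'a::chilbert_space \<Rightarrow> 'a"
  assumes T: "bounded_clinear T"
begin

text \<open>Riesz gives an adjoint \<open>S\<close> for \<open>inner\<close>; complex linearity of
  \<open>T\<close> makes it an adjoint for \<open>cinner\<close>, and uniqueness of adjoints
  evaluates the \<open>THE\<close> in \<open>cadjoint\<close>.\<close>

lemma cinner_cadjoint: "cinner (T x) y = cinner x (cadjoint T y)"
proof -
  have bl: "bounded_linear (\<lambda>x. inner (T x) y)" for y
    using T bounded_linear_compose[OF bounded_linear_inner_left]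
    by (auto simp: bounded_clinear_def)
  have "\<exists>w. \<forall>x. inner (T x) y = inner x w" for y
    using riesz_representation[OF bl] by metis
  then obtain S where S: "\<And>x y. inner (T x) y = inner x (S y)"
    by metis
  have S': "cinner (T x) y = cinner x (S y)" for x y
  proof -
    have "inner (T x) (\<i> *\<^sub>C y) = - inner (T (\<i> *\<^sub>C x)) y"
      using T by (simp add: bounded_clinear_def inner_eq_Re_cinner cinner_scaleC_left
          cinner_scaleC_right)
    also have "\<dots> = inner x (\<i> *\<^sub>C S y)"
      by (simp add: S) (simp add: inner_eq_Re_cinner cinner_scaleC_left cinner_scaleC_right)
    finally show ?thesis
      by (simp add: cinner_conv_inner S)
  qed
  have "cadjoint T = S"
    unfolding cadjoint_def
  proof (rule the_equality)
    show "S' = S" if "\<forall>x y. cinner (T x) y = cinner x (S' y)" for S'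
      using that S' by (intro ext cinner_ext) metis
  qed (use S' in blast)
  then show ?thesis
    using S' by blast
qed

lemma cinner_cadjoint': "cinner x (T y) = cinner (cadjoint T x) y"
  by (metis cinner_cadjoint cinner_commute)

lemma cadjoint_eq_0_iff: "cadjoint T x = 0 \<longleftrightarrow> x \<in> orth (range T)"
proof
  assume "x \<in> orth (range T)"
  then have "cinner (cadjoint T x) (cadjoint T x) = 0"
    by (simp add: orth_def flip: cinner_cadjoint')
  then show "cadjoint T x = 0"
    by simp
qed (auto simp: orth_def cinner_cadjoint')

lemma closed_csubspace_ker_cadjoint: "closed_csubspace {x. cadjoint T x = 0}"
  by (simp add: cadjoint_eq_0_iff closed_csubspace_orth)

lemma cadjoint_zero: "cadjoint T 0 = 0"
  by (simp add: cadjoint_eq_0_iff orth_def)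

lemma cadjoint_add: "cadjoint T (x + y) = cadjoint T x + cadjoint T y"
  by (rule cinner_ext) (simp add: cinner_add_right flip: cinner_cadjoint)

lemma bounded_clinear_funpow: "bounded_clinear (T ^^ m)"
proof (induction m)
  case 0
  show ?case
    by (simp add: bounded_clinear_def id_def)
next
  case (Suc m)
  then show ?case
    using T bounded_linear_compose by (auto simp: bounded_clinear_def o_def)
qed

text \<open>The preimage under \<open>T\<close> of the right-hand side is a closed subspace
  containing \<open>S\<close>, hence contains the closed span of \<open>S\<close>.\<close>

lemma image_closed_cspan_subset: "T ` closed_cspan S \<subseteq> closed_cspan (T ` S)"
proof -
  interpret bounded_linear T
    using T by (simp add: bounded_clinear_def)
  have "csubspace {x. T x \<in> closed_cspan (T ` S)}"
    using T closed_csubspace_closed_cspan[of "T ` S"]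
    by (simp add: complex_vector.subspace_def closed_csubspace_def bounded_clinear_def add zero)
  moreover have "closed {x. T x \<in> closed_cspan (T ` S)}"
    using continuous_closed_vimage[of "closed_cspan (T ` S)" T] isCont[OF continuous_ident]
      closed_csubspace_closed_cspan[of "T ` S"]
    by (simp add: closed_csubspace_def vimage_def)
  ultimately have "closed_cspan S \<subseteq> {x. T x \<in> closed_cspan (T ` S)}"
    using closed_cspan_superset[of "T ` S"]
    by (intro closed_cspan_minimal) (auto simp: closed_csubspace_def)
  then show ?thesis
    by blast
qed

lemma reducing_orth:
  assumes "reducing T M"
  shows "reducing T (orth M)"
  using assms unfolding reducing_def orth_def
  by (auto simp: closed_csubspace_orth[unfolded orth_def] image_subset_iff cinner_cadjoint)
    (metis cinner_cadjoint')

text \<open>Let \<open>h\<close> be the part of \<open>x\<close> orthogonal to the right-hand side;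
  it lies in \<open>K\<close> and in the span generated by \<open>E\<close>. Each \<open>e\<close>
  in \<open>E\<close> splits along \<open>K\<close> as \<open>y + z\<close> with \<open>y\<close> in
  \<open>K \<inter> E\<close>. Powers of \<open>T\<close> send \<open>y\<close> into the right-hand
  side and keep \<open>z\<close> in \<open>orth K\<close>, so both images are orthogonal to
  \<open>h\<close>. Thus \<open>h\<close> is orthogonal to a space containing it.\<close>

lemma reducing_Int_shift_span_subset:
  assumes "reducing T K"
  defines "E \<equiv> {x. cadjoint T x = 0}"
  shows "K \<inter> closed_cspan (\<Union>m. (T ^^ m) ` E) \<subseteq> closed_cspan (\<Union>m. (T ^^ m) ` (K \<inter> E))"
    (is "K \<inter> ?B \<subseteq> ?G")
proof
  fix x assume x: "x \<in> K \<inter> ?B"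
  have K: "closed_csubspace K" "\<And>x. x \<in> K \<Longrightarrow> T x \<in> K" "\<And>x. x \<in> K \<Longrightarrow> cadjoint T x \<in> K"
    using assms(1) by (auto simp: reducing_def)
  have "?G \<subseteq> K"
    using K by (intro closed_cspan_minimal) (auto intro: funpow_image_subset)
  have "?G \<subseteq> ?B"
    by (intro closed_cspan_mono) blast
  obtain g h where gh: "g \<in> ?G" "h \<in> orth ?G" "x = g + h"
    using orth_decomposition[OF closed_csubspace_closed_cspan] by metis
  have h: "h \<in> K" "h \<in> ?B"
    using x gh(1,3) \<open>?G \<subseteq> K\<close> \<open>?G \<subseteq> ?B\<close> closed_csubspace_diff[OF K(1), of x g]
      closed_csubspace_diff[OF closed_csubspace_closed_cspan, of x _ g] by auto
  have "(T ^^ m) e \<in> orth {h}" if e: "e \<in> E" for m e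
  proof -
    obtain y z where yz: "y \<in> K" "z \<in> orth K" "e = y + z"
      using orth_decomposition[OF K(1)] by metis
    have oK: "reducing T (orth K)"
      by (rule reducing_orth[OF assms(1)])
    have "cadjoint T y + cadjoint T z = 0"
      using e yz(3) by (simp add: E_def cadjoint_add)
    moreover have "cinner (cadjoint T z) (cadjoint T y) = 0"
      using oK yz(1,2) K(3) unfolding reducing_def by (fastforce simp: orth_def)
    ultimately have "cadjoint T y = 0"
      by (metis add.inverse_unique cinner_self_eq_0_iff cinner_add_left add.right_neutral
          cinner_zero_left add.commute)
    then have "(T ^^ m) y \<in> ?G"
      using yz(1) closed_cspan_superset[of "\<Union>m. (T ^^ m) ` (K \<inter> E)"] by (auto simp: E_def)
    then have "cinner ((T ^^ m) y) h = 0"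
      using gh(2) cinner_eq_0_commute by (auto simp: orth_def)
    moreover have "(T ^^ m) z \<in> orth K"
      using oK yz(2) by (auto simp: reducing_def intro: funpow_image_subset)
    then have "cinner ((T ^^ m) z) h = 0"
      using h(1) by (auto simp: orth_def)
    moreover have "(T ^^ m) e = (T ^^ m) y + (T ^^ m) z"
      using bounded_clinear_funpow[of m] yz(3)
      by (simp add: bounded_clinear_def bounded_linear.linear linear_add)
    ultimately show ?thesis
      by (simp add: orth_def cinner_add_left)
  qed
  then have "?B \<subseteq> orth {h}"
    by (intro closed_cspan_minimal closed_csubspace_orth) blast
  with h(2) have "h = 0"
    by (auto simp: orth_def)
  with gh show "x \<in> ?G"
    by simp
qed

text \<open>This makes the \<open>inv\<close> in \<open>canonical_left_inverse\<close> a genuine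
  inverse. Surjectivity rests on two facts: the range of \<open>T\<close> is closed, and the adjoint
  of \<open>T\<close> is onto because the adjoint of \<open>S\<close> is a right inverse of
  it.\<close>

lemma bij_cadjoint_comp:
  assumes "left_invertible T"
  shows "bij (cadjoint T \<circ> T)"
proof (rule bijI)
  interpret T: bounded_linear T
    using T by (simp add: bounded_clinear_def)
  obtain S where S: "bounded_clinear S" "S (T x) = x" for x
    using assms by (auto simp: left_invertible_def fun_eq_iff)
  then interpret S: bounded_linear S
    by (simp add: bounded_clinear_def)
  show "inj (cadjoint T \<circ> T)"
  proof (rule injI)
    fix x y assume "(cadjoint T \<circ> T) x = (cadjoint T \<circ> T) y"
    then have "cinner (T (x - y)) (T (x - y)) = 0"
      by (simp add: cinner_cadjoint T.diff cinner_diff_right cinner_diff_left)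
    then have "T (x - y) = 0"
      by simp
    then have "x - y = 0"
      using S(2)[of "x - y"] by (simp add: S.zero)
    then show "x = y"
      by simp
  qed
  \<comment> \<open>Since \<open>S\<close> inverts \<open>T\<close> from the left, the range is the
    fixed-point set of the continuous map \<open>T \<circ> S\<close>.\<close>
  have "range T = {x. T (S x) = x}"
    using S(2) by (auto simp: image_iff) metis
  then have "closed (range T)"
    by (simp add: closed_Collect_eq continuous_intros T.continuous_on S.continuous_on)
  moreover have "csubspace (range T)"
    unfolding complex_vector.subspace_def using T
    by (auto simp: bounded_clinear_def simp flip: T.add) (metis T.zero rangeI, metis rangeI)
  ultimately have ran: "closed_csubspace (range T)"
    by (simp add: closed_csubspace_def)
  have "\<exists>u. x = cadjoint T (T u)" for x
  proof -
    obtain u z where u: "z \<in> orth (range T)" "cadjoint S x = T u + z"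
      using orth_decomposition[OF ran] by (metis rangeE)
    \<comment> \<open>This is the adjoint of the identity \<open>S \<circ> T = id\<close>; the part
      \<open>z\<close> of \<open>cadjoint S x\<close> is then killed by
      \<open>cadjoint T\<close>.\<close>
    have "x = cadjoint T (cadjoint S x)"
      by (rule cinner_ext) (simp add: S flip: cinner_cadjoint Submission.cinner_cadjoint)
    also have "\<dots> = cadjoint T (T u)"
      using u cadjoint_eq_0_iff[of z] by (simp add: cadjoint_add)
    finally show ?thesis
      by blast
  qed
  then show "surj (cadjoint T \<circ> T)"
    by (auto simp: surj_def)
qed

text \<open>This turns commutation with a left inverse into invariance of the kernel of the
  adjoint.\<close>

lemma canonical_left_inverse_eq_0_iff:
  assumes "left_invertible T"
  shows "canonical_left_inverse T x = 0 \<longleftrightarrow> cadjoint T x = 0"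
proof -
  note b = bij_cadjoint_comp[OF assms]
  have "(cadjoint T \<circ> T) 0 = 0"
    using T by (simp add: bounded_clinear_def bounded_linear.linear linear_0 cadjoint_zero)
  then show ?thesis
    unfolding canonical_left_inverse_def
    by (metis b bij_inv_eq_iff comp_apply)
qed

text \<open>The inverse \<open>S\<close> provided by \<open>unitary_on\<close> agrees with the
  global adjoint: for \<open>y\<close> in the reducing subspace \<open>M\<close>, the difference
  \<open>cadjoint T y - S y\<close> lies in \<open>M\<close> and is orthogonal to
  \<open>M\<close>.\<close>

lemma unitary_on_cadjoint:
  assumes "unitary_on M T" "reducing T M" "x \<in> M"
  shows "cadjoint T (T x) = x" "T (cadjoint T x) = x"
proof -
  obtain S where S: "S ` M \<subseteq> M" "\<And>x y. x \<in> M \<Longrightarrow> y \<in> M \<Longrightarrow> cinner (T x) y = cinner x (S y)"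
      "\<And>x. x \<in> M \<Longrightarrow> S (T x) = x \<and> T (S x) = x"
    using assms(1) unfolding unitary_on_def by blast
  have eq: "cadjoint T y = S y" if "y \<in> M" for y
  proof -
    have "cadjoint T y - S y \<in> M"
      using assms(2) S(1) that by (intro closed_csubspace_diff) (auto simp: reducing_def)
    then have "cinner (cadjoint T y - S y) (cadjoint T y - S y) = 0"
      using S(2)[OF _ that] by (simp add: cinner_cadjoint cinner_diff_right)
    then show ?thesis
      by simp
  qed
  have "T x \<in> M"
    using assms by (auto simp: unitary_on_def)
  with eq S(3) assms(3) show "cadjoint T (T x) = x" "T (cadjoint T x) = x"
    by auto
qed

lemma unitary_on_subset:
  assumes "unitary_on M T" "reducing T M" "reducing T N" "N \<subseteq> M"
  shows "unitary_on N T"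
  unfolding unitary_on_def
  using assms(3,4) unitary_on_cadjoint[OF assms(1,2)]
  by (intro conjI exI[of _ "cadjoint T"]) (auto simp: reducing_def cinner_cadjoint)

end

section \<open>Wold-type decompositions of commuting operators\<close>

text \<open>Agreement on \<open>I\<close> is what is available later: components and joint summands
  are compared only at binary indices.\<close>

lemma orthogonal_direct_sum_eq_on:
  assumes M: "orthogonal_direct_sum I M" and eq: "\<And>i. i \<in> I \<Longrightarrow> N i = M i"
  shows "orthogonal_direct_sum I N"
  unfolding orthogonal_direct_sum_def
proof (intro conjI allI)
  fix x
  obtain u where "\<And>i. i \<in> I \<Longrightarrow> u i \<in> M i" "x = (\<Sum>i\<in>I. u i)"
    using M unfolding orthogonal_direct_sum_def by metis
  then show "\<exists>u. (\<forall>i\<in>I. u i \<in> N i) \<and> x = (\<Sum>i\<in>I. u i)"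
    using eq by (intro exI[of _ u]) simp
qed (use M eq in \<open>simp_all add: orthogonal_direct_sum_def\<close>)

lemma cinner_orth: "x \<in> M \<Longrightarrow> y \<in> orth M \<Longrightarrow> cinner x y = 0"
  using cinner_eq_0_commute by (auto simp: orth_def)

lemma orth_Int_eq_0: "x \<in> M \<Longrightarrow> x \<in> orth M \<Longrightarrow> x = 0"
  by (auto simp: orth_def)

lemma orth_orth:
  fixes M :: "'a::chilbert_space set"
  assumes "closed_csubspace M"
  shows "orth (orth M) = M"
proof
  show "M \<subseteq> orth (orth M)"
    using cinner_orth by (fastforce simp: orth_def[of "orth M"])
  show "orth (orth M) \<subseteq> M"
  proof
    fix x assume x: "x \<in> orth (orth M)"
    obtain y z where yz: "y \<in> M" "z \<in> orth M" "x = y + z"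
      using orth_decomposition[OF assms] by metis
    have "cinner x z = 0" "cinner y z = 0"
      using x yz cinner_orth by (auto simp: orth_def)
    then have "z = 0"
      by (simp add: yz(3) cinner_add_left)
    with yz show "x \<in> M"
      by simp
  qed
qed

lemma H_infinity_iff: "x \<in> H_infinity T \<longleftrightarrow> (\<forall>m. x \<in> range (T ^^ m))"
proof -
  have "x \<in> range (T ^^ m)" if "x \<in> H_infinity T" for m
    using that by (cases "m = 0") (auto simp: H_infinity_def Ball_def)
  then show ?thesis
    by (auto simp: H_infinity_def)
qed

text \<open>If \<open>x\<close> is orthogonal to the first summand, then its component there is
  orthogonal to itself.\<close>

lemma orth_H_infinity:
  assumes "wold_type_decomposition T"
  shows "orth (H_infinity T) = closed_cspan (\<Union>m. (T ^^ m) ` {x. cadjoint T x = 0})"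
    (is "orth ?A = ?B")
proof
  define M where "M = (\<lambda>b. if b then ?A else ?B)"
  have M: "orthogonal_direct_sum UNIV M"
    using assms by (simp add: wold_type_decomposition_def M_def)
  then have perp: "cinner b a = 0" if "a \<in> ?A" "b \<in> ?B" for a b
    using that unfolding orthogonal_direct_sum_def M_def
    by (metis UNIV_I)
  then show "?B \<subseteq> orth ?A"
    by (auto simp: orth_def)
  show "orth ?A \<subseteq> ?B"
  proof
    fix x assume x: "x \<in> orth ?A"
    obtain u where u: "\<And>b. u b \<in> M b" "x = (\<Sum>b\<in>UNIV. u b)"
      using M unfolding orthogonal_direct_sum_def by (metis UNIV_I)
    then have eq: "x = u True + u False" and "u True \<in> ?A" "u False \<in> ?B"
      using u(1)[of True] u(1)[of False] by (simp_all add: UNIV_bool M_def add.commute)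
    moreover have "cinner x (u True) = 0"
      using x \<open>u True \<in> ?A\<close> by (auto simp: orth_def)
    ultimately have "u True = 0"
      using perp by (simp add: cinner_add_left)
    with eq \<open>u False \<in> ?B\<close> show "x \<in> ?B"
      by simp
  qed
qed

lemma ker_cadjoint_subset_orth_H_infinity:
  assumes "wold_type_decomposition T"
  shows "{x. cadjoint T x = 0} \<subseteq> orth (H_infinity T)"
proof -
  have "{x. cadjoint T x = 0} \<subseteq> (\<Union>m. (T ^^ m) ` {x. cadjoint T x = 0})"
    by (rule subset_trans[OF _ UN_upper[of 0]]) simp_all
  then show ?thesis
    unfolding orth_H_infinity[OF assms] using closed_cspan_superset by blast
qed

lemma funpow_commute:
  assumes "T \<circ> S = S \<circ> T"
  shows "S ((T ^^ m) x) = (T ^^ m) (S x)"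
  using assms by (induction m) (simp_all add: fun_eq_iff, metis)

text \<open>Invariance under \<open>S\<close> comes from commutation with the left inverse, whose
  kernel is that of \<open>cadjoint T\<close>. Invariance under \<open>cadjoint S\<close> comes from
  \<open>T \<circ> S = S \<circ> T\<close> by taking adjoints.\<close>

lemma reducing_ker_cadjoint:
  fixes T S :: "'a::chilbert_space \<Rightarrow> 'a"
  assumes T: "bounded_clinear T" "left_invertible T" and S: "bounded_clinear S"
    and comm: "T \<circ> S = S \<circ> T"
    and lcomm: "canonical_left_inverse T \<circ> S = S \<circ> canonical_left_inverse T"
  shows "reducing S {x. cadjoint T x = 0}"
proof -
  have "cadjoint T (S x) = 0" if "cadjoint T x = 0" for x
  proof -
    have "canonical_left_inverse T (S x) = S 0"
      using lcomm that canonical_left_inverse_eq_0_iff[OF T, of x] by (simp add: fun_eq_iff)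
    then show ?thesis
      using S canonical_left_inverse_eq_0_iff[OF T, of "S x"]
      by (simp add: bounded_clinear_def bounded_linear.linear linear_0)
  qed
  moreover have "cadjoint T (cadjoint S x) = 0" if "cadjoint T x = 0" for x
  proof (rule cinner_ext)
    fix z
    have "cinner z (cadjoint T (cadjoint S x)) = cinner (T (S z)) x"
      using comm by (simp add: fun_eq_iff flip: cinner_cadjoint[OF T(1)] cinner_cadjoint[OF S])
    then show "cinner z (cadjoint T (cadjoint S x)) = cinner z 0"
      by (simp add: cinner_cadjoint[OF T(1)] that)
  qed
  ultimately show ?thesis
    using closed_csubspace_ker_cadjoint[OF T(1)] by (auto simp: reducing_def)
qed

text \<open>Commutation makes \<open>S\<close> preserve every range of a power of \<open>T\<close>.
  The complement is generated by the kernel of \<open>cadjoint T\<close>, so \<open>S\<close>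
  preserves it too; by duality \<open>cadjoint S\<close> preserves the double complement, which is
  \<open>H_infinity T\<close>.\<close>

lemma reducing_H_infinity:
  fixes T S :: "'a::chilbert_space \<Rightarrow> 'a"
  assumes "wold_type_decomposition T" and S: "bounded_clinear S" and comm: "T \<circ> S = S \<circ> T"
    and ker: "\<And>x. cadjoint T x = 0 \<Longrightarrow> cadjoint T (S x) = 0"
  shows "reducing S (H_infinity T)"
proof -
  let ?A = "H_infinity T" and ?U = "\<Union>m. (T ^^ m) ` {x. cadjoint T x = 0}"
  have cA: "closed_csubspace ?A"
    using assms(1) by (simp add: wold_type_decomposition_def reducing_def)
  have "S x \<in> ?A" if "x \<in> ?A" for x
    unfolding H_infinity_iff
  proof
    fix m
    have "x \<in> range (T ^^ m)"
      using that by (simp only: H_infinity_iff)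
    then obtain y where "x = (T ^^ m) y"
      by (rule rangeE)
    then have "S x = (T ^^ m) (S y)"
      by (simp only: funpow_commute[OF comm])
    then show "S x \<in> range (T ^^ m)"
      by (rule range_eqI)
  qed
  then have "S ` ?A \<subseteq> ?A"
    by blast
  have "S ((T ^^ m) x) \<in> ?U" if "cadjoint T x = 0" for m x
    unfolding funpow_commute[OF comm] using ker[OF that] by blast
  then have "S ` ?U \<subseteq> ?U"
    by blast
  then have B: "S ` orth ?A \<subseteq> orth ?A"
    unfolding orth_H_infinity[OF assms(1)]
    by (rule subset_trans[OF image_closed_cspan_subset[OF S] closed_cspan_mono])
  have "cadjoint S x \<in> orth (orth ?A)" if "x \<in> ?A" for x
    unfolding orth_def[of "orth ?A"]
  proof (intro CollectI ballI)
    fix y assume "y \<in> orth ?A"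
    with B have "S y \<in> orth ?A"
      by blast
    then show "cinner (cadjoint S x) y = 0"
      using cinner_orth[OF that] by (simp only: flip: cinner_cadjoint'[OF S])
  qed
  with cA \<open>S ` ?A \<subseteq> ?A\<close> show ?thesis
    by (auto simp: reducing_def orth_orth)
qed

text \<open>The orthogonal projection onto \<open>M\<close> commutes with \<open>T\<close>, so it
  preserves the range of each power.\<close>

lemma orth_component_H_infinity:
  fixes T :: "'a::chilbert_space \<Rightarrow> 'a"
  assumes T: "bounded_clinear T" and M: "reducing T M"
    and ab: "a \<in> M" "b \<in> orth M" "a + b \<in> H_infinity T"
  shows "a \<in> H_infinity T"
  unfolding H_infinity_iff
proof
  fix m
  have cM: "closed_csubspace M"
    using M by (simp add: reducing_def)
  obtain y where y: "a + b = (T ^^ m) y"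
    using ab(3) unfolding H_infinity_iff by blast
  obtain y0 y1 where y01: "y0 \<in> M" "y1 \<in> orth M" "y = y0 + y1"
    using orth_decomposition[OF cM] by metis
  have "(T ^^ m) y0 \<in> M" "(T ^^ m) y1 \<in> orth M"
    using M reducing_orth[OF T M] y01
    unfolding reducing_def by (meson funpow_image_subset)+
  moreover have "(T ^^ m) y = (T ^^ m) y0 + (T ^^ m) y1"
    using bounded_clinear_funpow[OF T, of m] y01(3)
    by (simp add: bounded_clinear_def bounded_linear.linear linear_add)
  then have "a - (T ^^ m) y0 = (T ^^ m) y1 - b"
    using y by (simp add: algebra_simps)
  \<comment> \<open>One side of the last equation lies in \<open>M\<close>, the other in
    \<open>orth M\<close>.\<close>
  ultimately have "a - (T ^^ m) y0 = 0"
    using ab closed_csubspace_diff[OF cM] closed_csubspace_diff[OF closed_csubspace_orth]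
    by (metis orth_Int_eq_0)
  then show "a \<in> range (T ^^ m)"
    by auto
qed

text \<open>An orthogonal projection is self-adjoint: if it preserves \<open>N\<close>, it preserves
  \<open>orth N\<close>.\<close>

lemma orth_component_orth:
  fixes M N :: "'a::chilbert_space set"
  assumes "closed_csubspace M"
    and N: "\<And>a b. a \<in> M \<Longrightarrow> b \<in> orth M \<Longrightarrow> a + b \<in> N \<Longrightarrow> a \<in> N"
    and ab: "a \<in> M" "b \<in> orth M" "a + b \<in> orth N"
  shows "a \<in> orth N"
  unfolding orth_def
proof (intro CollectI ballI)
  fix y assume y: "y \<in> N"
  obtain y0 y1 where y01: "y0 \<in> M" "y1 \<in> orth M" "y = y0 + y1"
    using orth_decomposition[OF assms(1)] by metis
  then have "cinner (a + b) y0 = 0"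
    using N y ab(3) by (auto simp: orth_def)
  moreover have "cinner b y0 = 0" "cinner a y1 = 0"
    using ab y01 cinner_orth by (auto simp: orth_def)
  ultimately show "cinner a y = 0"
    by (simp add: y01(3) cinner_add_right cinner_add_left)
qed

section \<open>Products of powers along a list of indices\<close>

primrec funpow_list :: "(nat \<Rightarrow> 'a \<Rightarrow> 'a) \<Rightarrow> (nat \<Rightarrow> nat) \<Rightarrow> nat list \<Rightarrow> 'a \<Rightarrow> 'a" where
  "funpow_list T m [] = id"
| "funpow_list T m (i # l) = (T i ^^ m i) \<circ> funpow_list T m l"

text \<open>With the list as a free parameter, \<open>funpow_list\<close> admits induction that
  peels off one index at a time.\<close>

lemma multi_power_eq: "multi_power n T m = funpow_list T m [1..<Suc n]"
proof -
  have "foldr (\<lambda>i f. (T i ^^ m i) \<circ> f) l id = funpow_list T m l" for l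
    by (induction l) simp_all
  then show ?thesis
    by (simp only: multi_power_def)
qed

lemma subset_funpow_image:
  assumes "X \<subseteq> T ` X"
  shows "X \<subseteq> (T ^^ m) ` X"
proof (induction m)
  case (Suc m)
  have "X \<subseteq> T ` (T ^^ m) ` X"
    using assms Suc by blast
  then show ?case
    by (simp only: funpow.simps image_comp)
qed simp

lemma funpow_list_invariant:
  assumes "\<And>i. i \<in> set l \<Longrightarrow> m i \<noteq> 0 \<Longrightarrow> T i ` X \<subseteq> X" "x \<in> X"
  shows "funpow_list T m l x \<in> X"
  using assms
proof (induction l)
  case (Cons i l)
  then have "funpow_list T m l x \<in> X"
    by simp
  with Cons.prems(1)[of i] show ?case
    by (cases "m i = 0") (auto simp: funpow_image_subset)
qed simp

text \<open>Factors with exponent zero are the identity, so surjectivity is asked only of operators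
  that really occur.\<close>

lemma funpow_list_surj:
  assumes "\<And>i. i \<in> set l \<Longrightarrow> m i \<noteq> 0 \<Longrightarrow> X \<subseteq> T i ` X"
  shows "X \<subseteq> funpow_list T m l ` X"
  using assms
proof (induction l)
  case (Cons i l)
  have "X \<subseteq> funpow_list T m l ` X"
    by (rule Cons.IH) (simp add: Cons.prems)
  moreover have "X \<subseteq> (T i ^^ m i) ` X"
    using Cons.prems[of i] by (cases "m i = 0") (auto intro!: subset_funpow_image)
  ultimately have "X \<subseteq> (T i ^^ m i) ` funpow_list T m l ` X"
    by blast
  then show ?case
    by (simp only: funpow_list.simps image_comp)
qed simp

lemma funpow_list_id: "(\<And>i. i \<in> set l \<Longrightarrow> m i = 0) \<Longrightarrow> funpow_list T m l = id"
  by (induction l) auto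

lemma funpow_list_single:
  "i \<in> set l \<Longrightarrow> distinct l \<Longrightarrow> (\<And>j. j \<in> set l \<Longrightarrow> j \<noteq> i \<Longrightarrow> m j = 0) \<Longrightarrow>
    funpow_list T m l = T i ^^ m i"
proof (induction l)
  case (Cons j l)
  show ?case
  proof (cases "i = j")
    case True
    with Cons.prems have "funpow_list T m l = id"
      by (intro funpow_list_id) auto
    with True show ?thesis
      by simp
  next
    case False
    with Cons show ?thesis
      by auto
  qed
qed simp

lemma funpow_list_cong:
  "(\<And>i. i \<in> set l \<Longrightarrow> m i = m' i) \<Longrightarrow> funpow_list T m l = funpow_list T m' l"
  by (induction l) auto

section \<open>Joint summands of the tuple and their identification with the Wold components\<close>

context
  fixes T :: "nat \<Rightarrow> 'a::chilbert_space \<Rightarrow> 'a" and n :: nat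
  assumes lic: "left_inverse_commuting n T"
    and wold: "\<And>i. i \<in> {1..n} \<Longrightarrow> wold_type_decomposition (T i)"
begin

definition wold_summand :: "nat \<Rightarrow> nat \<Rightarrow> 'a set" where
  "wold_summand i c = (if c = 0 then H_infinity (T i) else orth (H_infinity (T i)))"

definition joint_summand :: "(nat \<Rightarrow> nat) \<Rightarrow> 'a set" where
  "joint_summand \<alpha> = (\<Inter>i\<in>{1..n}. wold_summand i (\<alpha> i))"

lemma joint_summand_subset: "i \<in> {1..n} \<Longrightarrow> joint_summand \<alpha> \<subseteq> wold_summand i (\<alpha> i)"
  unfolding joint_summand_def by (rule INT_lower)

lemmas lic_conjs =
  conjunct1[OF lic[unfolded left_inverse_commuting_def]]
  conjunct1[OF conjunct2[OF lic[unfolded left_inverse_commuting_def]]]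
  conjunct2[OF conjunct2[OF lic[unfolded left_inverse_commuting_def]]]

lemma bounded_clinear_T: "i \<in> {1..n} \<Longrightarrow> bounded_clinear (T i)"
  by (rule conjunct1[OF bspec[OF lic_conjs(1)]])

lemma T_commute: "i \<in> {1..n} \<Longrightarrow> j \<in> {1..n} \<Longrightarrow> T i \<circ> T j = T j \<circ> T i"
  by (rule bspec[OF bspec[OF lic_conjs(2)]])

lemma reducing_ker_T:
  assumes "i \<in> {1..n}" "j \<in> {1..n}" "i \<noteq> j"
  shows "reducing (T i) {x. cadjoint (T j) x = 0}"
proof (rule reducing_ker_cadjoint)
  show "left_invertible (T j)"
    by (rule conjunct2[OF bspec[OF lic_conjs(1) assms(2)]])
  show "canonical_left_inverse (T j) \<circ> T i = T i \<circ> canonical_left_inverse (T j)"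
    by (rule mp[OF bspec[OF bspec[OF lic_conjs(3) assms(2)] assms(1)] assms(3)[symmetric]])
qed (intro bounded_clinear_T T_commute assms)+

lemma reducing_H_infinity_T:
  assumes "i \<in> {1..n}" "j \<in> {1..n}"
  shows "reducing (T i) (H_infinity (T j))"
proof (cases "i = j")
  case True
  with wold[OF assms(1)] show ?thesis
    by (simp add: wold_type_decomposition_def)
next
  case False
  show ?thesis
  proof (rule reducing_H_infinity[OF wold[OF assms(2)] bounded_clinear_T[OF assms(1)]
        T_commute[OF assms(2,1)]])
    show "cadjoint (T j) (T i x) = 0" if "cadjoint (T j) x = 0" for x
      using reducing_ker_T[OF assms False] that unfolding reducing_def by blast
  qed
qed

lemma reducing_wold_summand:
  "i \<in> {1..n} \<Longrightarrow> j \<in> {1..n} \<Longrightarrow> reducing (T i) (wold_summand j c)"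
  by (simp add: wold_summand_def reducing_H_infinity_T reducing_orth bounded_clinear_T)

lemma closed_csubspace_wold_summand: "i \<in> {1..n} \<Longrightarrow> closed_csubspace (wold_summand i c)"
  using reducing_wold_summand[of i i] by (simp add: reducing_def)

lemma reducing_joint_summand: "i \<in> {1..n} \<Longrightarrow> reducing (T i) (joint_summand \<alpha>)"
  unfolding joint_summand_def
  by (intro reducing_INT reducing_wold_summand)

lemma closed_csubspace_joint_summand: "closed_csubspace (joint_summand \<alpha>)"
  unfolding joint_summand_def
  by (intro closed_csubspace_INT closed_csubspace_wold_summand)

lemma unitary_on_joint_summand:
  assumes "i \<in> {1..n}" "\<alpha> i = 0"
  shows "unitary_on (joint_summand \<alpha>) (T i)"
proof (rule unitary_on_subset[OF bounded_clinear_T[OF assms(1)]])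
  show "unitary_on (H_infinity (T i)) (T i)"
    using wold[OF assms(1)] by (simp add: wold_type_decomposition_def)
  show "joint_summand \<alpha> \<subseteq> H_infinity (T i)"
    using joint_summand_subset[OF assms(1), of \<alpha>] by (simp add: wold_summand_def assms(2))
qed (intro reducing_H_infinity_T reducing_joint_summand assms(1))+

text \<open>The projections onto the spaces \<open>H_infinity (T i)\<close> are compatible: each one
  preserves both Wold summands of every \<open>T j\<close>.\<close>

lemma wold_summand_component:
  assumes ij: "i \<in> {1..n}" "j \<in> {1..n}"
    and ab: "a \<in> wold_summand i 0" "b \<in> wold_summand i 1" "a + b \<in> wold_summand j c"
  shows "a \<in> wold_summand j c" "b \<in> wold_summand j c"
proof -
  let ?M = "H_infinity (T i)" and ?N = "H_infinity (T j)"
  have ab': "a \<in> ?M" "b \<in> orth ?M"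
    using ab by (simp_all add: wold_summand_def)
  have N: "a \<in> ?N" if "a \<in> ?M" "b \<in> orth ?M" "a + b \<in> ?N" for a b
    by (rule orth_component_H_infinity[OF bounded_clinear_T[OF ij(2)]
          reducing_H_infinity_T[OF ij(2,1)] that])
  have "closed_csubspace ?M"
    using closed_csubspace_wold_summand[OF ij(1), of 0] by (simp add: wold_summand_def)
  then show a: "a \<in> wold_summand j c"
    using N ab' ab(3) orth_component_orth[of ?M ?N a b] by (auto simp: wold_summand_def)
  show "b \<in> wold_summand j c"
    using closed_csubspace_diff[OF closed_csubspace_wold_summand[OF ij(2)] ab(3) a] by simp
qed

text \<open>Induction on the index set: each term is split along the new index \<open>i\<close>, and
  by \<open>wold_summand_component\<close> both pieces remain in the summands already
  reached.\<close>

lemma sum_wold_summands: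
  assumes "finite I" "I \<subseteq> {1..n}"
  shows "\<exists>u. (\<forall>\<alpha>\<in>I \<rightarrow>\<^sub>E {0, 1}. \<forall>i\<in>I. u \<alpha> \<in> wold_summand i (\<alpha> i)) \<and>
    x = (\<Sum>\<alpha>\<in>I \<rightarrow>\<^sub>E {0, 1}. u \<alpha>)"
  using assms
proof (induction I rule: finite_induct)
  case empty
  then show ?case
    by (intro exI[of _ "\<lambda>_. x"]) simp
next
  case (insert i I)
  then obtain u where u: "\<And>\<alpha> j. \<alpha> \<in> I \<rightarrow>\<^sub>E {0, 1} \<Longrightarrow> j \<in> I \<Longrightarrow> u \<alpha> \<in> wold_summand j (\<alpha> j)"
      "x = (\<Sum>\<alpha>\<in>I \<rightarrow>\<^sub>E {0, 1}. u \<alpha>)"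
    by auto
  have i: "i \<in> {1..n}"
    using insert.prems by simp
  have "\<exists>a b. a \<in> wold_summand i 0 \<and> b \<in> wold_summand i 1 \<and> u \<alpha> = a + b" for \<alpha>
    using orth_decomposition[OF closed_csubspace_wold_summand[OF i, of 0]]
    unfolding wold_summand_def by (metis one_neq_zero)
  then obtain p q where pq: "\<And>\<alpha>. p \<alpha> \<in> wold_summand i 0" "\<And>\<alpha>. q \<alpha> \<in> wold_summand i 1"
      "\<And>\<alpha>. u \<alpha> = p \<alpha> + q \<alpha>"
    by metis
  define v where "v = (\<lambda>c \<alpha>. if c = (0::nat) then p \<alpha> else q \<alpha>)"
  have v_i: "v c \<alpha> \<in> wold_summand i c" for c \<alpha>
    using pq by (simp add: v_def wold_summand_def)
  have v_j: "v c \<alpha> \<in> wold_summand j (\<alpha> j)" if "\<alpha> \<in> I \<rightarrow>\<^sub>E {0, 1}" "j \<in> I" for c \<alpha> j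
    using wold_summand_component[OF i _ pq(1,2), of j \<alpha> \<alpha>] u(1)[OF that] pq(3) insert.prems that
    by (auto simp: v_def)
  have ins: "insert i I \<rightarrow>\<^sub>E {0, 1::nat} =
      (\<lambda>(c, \<alpha>). \<alpha>(i := c)) ` ({0, 1} \<times> (I \<rightarrow>\<^sub>E {0, 1}))"
    by (rule PiE_insert_eq)
  have inj: "inj_on (\<lambda>(c, \<alpha>). \<alpha>(i := c)) ({0, 1::nat} \<times> (I \<rightarrow>\<^sub>E {0, 1::nat}))"
    by (rule inj_combinator[OF insert.hyps(2)])
  have restr: "restrict (\<alpha>(i := c)) I = \<alpha>" if "\<alpha> \<in> I \<rightarrow>\<^sub>E {0, 1::nat}" for c \<alpha>
    using that insert.hyps(2) by (auto simp: restrict_def PiE_def extensional_def fun_eq_iff)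
  \<comment> \<open>An index on \<open>insert i I\<close> is a value at \<open>i\<close>, which
    selects the piece, together with its restriction to \<open>I\<close>, which selects the old
    term.\<close>
  let ?w = "\<lambda>\<beta>. v (\<beta> i) (restrict \<beta> I)"
  have "(\<Sum>\<beta>\<in>insert i I \<rightarrow>\<^sub>E {0, 1}. ?w \<beta>) =
      (\<Sum>(c, \<alpha>)\<in>{0, 1} \<times> (I \<rightarrow>\<^sub>E {0, 1}). v c \<alpha>)"
    unfolding ins sum.reindex[OF inj] by (intro sum.cong) (auto simp: restr)
  also have "\<dots> = x"
    by (simp add: sum.cartesian_product[symmetric] v_def u(2) pq(3) sum.distrib)
  finally have "x = (\<Sum>\<beta>\<in>insert i I \<rightarrow>\<^sub>E {0, 1}. ?w \<beta>)"
    by simp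
  moreover have "?w \<beta> \<in> wold_summand j (\<beta> j)" if "\<beta> \<in> insert i I \<rightarrow>\<^sub>E {0, 1}" "j \<in> insert i I" for \<beta> j
  proof (cases "j = i")
    case True
    then show ?thesis
      by (simp add: v_i)
  next
    case False
    with that have "restrict \<beta> I \<in> I \<rightarrow>\<^sub>E {0, 1}" "j \<in> I"
      by (auto simp: PiE_iff)
    then show ?thesis
      using v_j[of "restrict \<beta> I" j "\<beta> i"] by simp
  qed
  ultimately show ?case
    by (intro exI[of _ ?w]) blast
qed

text \<open>Distinct binary indices differ at some \<open>i\<close>, which puts the two joint
  summands into complementary Wold summands of \<open>T i\<close>.\<close>

lemma orthogonal_direct_sum_joint_summand:
  "orthogonal_direct_sum (binary_indices n) joint_summand"
  unfolding orthogonal_direct_sum_def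
proof (intro conjI ballI impI allI closed_csubspace_joint_summand)
  show "finite (binary_indices n)"
    unfolding binary_indices_def by (rule finite_PiE) simp_all
  show "\<exists>u. (\<forall>\<alpha>\<in>binary_indices n. u \<alpha> \<in> joint_summand \<alpha>) \<and> x = (\<Sum>\<alpha>\<in>binary_indices n. u \<alpha>)" for x
    using sum_wold_summands[of "{1..n}" x] by (simp add: binary_indices_def joint_summand_def)
  fix \<alpha> \<beta> x y
  assume ab: "\<alpha> \<in> binary_indices n" "\<beta> \<in> binary_indices n" "\<alpha> \<noteq> \<beta>"
    and xy: "x \<in> joint_summand \<alpha>" "y \<in> joint_summand \<beta>"
  then obtain i where i: "i \<in> {1..n}" "\<alpha> i \<noteq> \<beta> i"
    using PiE_ext[of \<alpha> "{1..n}" "\<lambda>_. {0, 1}" \<beta>]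
    unfolding binary_indices_def by blast
  have "\<alpha> i \<in> {0, 1}" "\<beta> i \<in> {0, 1}"
    using ab(1,2) i(1) unfolding binary_indices_def by (auto dest: PiE_mem)
  with i(2) have "\<alpha> i = 0 \<and> \<beta> i = 1 \<or> \<alpha> i = 1 \<and> \<beta> i = 0"
    by auto
  moreover have "x \<in> wold_summand i (\<alpha> i)" "y \<in> wold_summand i (\<beta> i)"
    using xy joint_summand_subset[OF i(1)] by blast+
  ultimately show "cinner x y = 0"
    using cinner_orth cinner_eq_0_commute by (fastforce simp: wold_summand_def)
qed

text \<open>Induction on the list, with \<open>K\<close> recording the conditions already treated.
  If \<alpha> is 1 at the head \<open>i\<close>, the one-operator result replaces
  \<open>orth (H_infinity (T i))\<close> by the kernel of the adjoint of \<open>T i\<close>, which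
  joins \<open>K\<close> for the remaining indices.\<close>

lemma reducing_Int_joint_shift_span_subset:
  assumes "distinct l" "set l \<subseteq> {1..n}" "\<And>i. i \<in> set l \<Longrightarrow> \<alpha> i \<in> {0, 1}"
    and "closed_csubspace K" "\<And>i. i \<in> set l \<Longrightarrow> reducing (T i) K"
  shows "K \<inter> (\<Inter>i\<in>{i\<in>set l. \<alpha> i = 1}. orth (H_infinity (T i))) \<subseteq>
    closed_cspan (\<Union>m. funpow_list T (index_mult \<alpha> m) l `
      (K \<inter> (\<Inter>i\<in>{i\<in>set l. \<alpha> i = 1}. {x. cadjoint (T i) x = 0})))"
  using assms
proof (induction l arbitrary: K)
  case Nil
  then show ?case
    using closed_cspan_superset[of K] by simp
next
  case (Cons i l)
  let ?F = "\<lambda>l m. funpow_list T (index_mult \<alpha> m) l"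
  let ?B = "\<lambda>l. \<Inter>i\<in>{i\<in>set l. \<alpha> i = 1}. orth (H_infinity (T i))"
  let ?E = "\<lambda>l. \<Inter>i\<in>{i\<in>set l. \<alpha> i = 1}. {x. cadjoint (T i) x = 0}"
  let ?Ei = "{x. cadjoint (T i) x = 0}"
  have i: "i \<in> {1..n}" "i \<notin> set l"
    using Cons.prems by auto
  show ?case
  proof (cases "\<alpha> i = 1")
    case False
    then have "\<alpha> i = 0"
      using Cons.prems(3)[of i] by simp
    then have set: "{j \<in> set (i # l). \<alpha> j = 1} = {j \<in> set l. \<alpha> j = 1}"
      and F: "?F (i # l) m = ?F l m" for m
      by (auto simp: index_mult_def)
    show ?thesis
      unfolding set F by (rule Cons.IH) (use Cons.prems in simp_all)
  next
    case True
    then have set: "{j \<in> set (i # l). \<alpha> j = 1} = insert i {j \<in> set l. \<alpha> j = 1}"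
      by auto
    let ?G = "closed_cspan (\<Union>m. ?F (i # l) m ` (K \<inter> ?E (i # l)))"
    have "K \<inter> ?B (i # l) = (K \<inter> ?B l) \<inter> orth (H_infinity (T i))"
      unfolding set by auto
    \<comment> \<open>The one-operator result is applied to \<open>K \<inter> ?B l\<close>, which
      reduces \<open>T i\<close>.\<close>
    also have "\<dots> \<subseteq> closed_cspan (\<Union>m. (T i ^^ m) ` ((K \<inter> ?B l) \<inter> ?Ei))"
      unfolding orth_H_infinity[OF wold[OF i(1)]]
    proof (intro reducing_Int_shift_span_subset reducing_Int reducing_INT bounded_clinear_T i(1))
      show "reducing (T i) K"
        using Cons.prems(5) by simp
      fix j assume "j \<in> {j\<in>set l. \<alpha> j = 1}"
      then have "j \<in> {1..n}"
        using Cons.prems(2) by auto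
      from reducing_orth[OF bounded_clinear_T[OF i(1)] reducing_H_infinity_T[OF i(1) this]]
      show "reducing (T i) (orth (H_infinity (T j)))" .
    qed
    also have "\<dots> \<subseteq> ?G"
    proof (rule closed_cspan_minimal[OF _ closed_csubspace_closed_cspan], rule UN_least)
      fix k
      \<comment> \<open>The induction hypothesis needs \<open>K \<inter> ?Ei\<close> to reduce the
        later operators; this holds because left-inverse commutation makes \<open>?Ei\<close>
        reducing for every \<open>T j\<close> with \<open>j \<noteq> i\<close>.\<close>
      have "(K \<inter> ?Ei) \<inter> ?B l \<subseteq> closed_cspan (\<Union>m. ?F l m ` ((K \<inter> ?Ei) \<inter> ?E l))"
      proof (rule Cons.IH)
        show "closed_csubspace (K \<inter> ?Ei)"
          by (intro closed_csubspace_Int Cons.prems(4) closed_csubspace_ker_cadjoint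
              bounded_clinear_T i(1))
        fix j assume j: "j \<in> set l"
        then have "j \<in> {1..n}" "j \<noteq> i"
          using Cons.prems(2) i(2) by auto
        moreover have "reducing (T j) K"
          using Cons.prems(5) j by simp
        ultimately show "reducing (T j) (K \<inter> ?Ei)"
          by (intro reducing_Int reducing_ker_T i(1))
      qed (use Cons.prems in simp_all)
      then have "(T i ^^ k) ` ((K \<inter> ?B l) \<inter> ?Ei) \<subseteq>
          (T i ^^ k) ` closed_cspan (\<Union>m. ?F l m ` ((K \<inter> ?Ei) \<inter> ?E l))"
        by (intro image_mono) blast
      also have "\<dots> \<subseteq> closed_cspan ((T i ^^ k) ` (\<Union>m. ?F l m ` ((K \<inter> ?Ei) \<inter> ?E l)))"
        by (intro image_closed_cspan_subset bounded_clinear_funpow bounded_clinear_T i)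
      also have "\<dots> \<subseteq> ?G"
      proof (rule closed_cspan_mono, rule subsetI)
        fix x assume "x \<in> (T i ^^ k) ` (\<Union>m. ?F l m ` ((K \<inter> ?Ei) \<inter> ?E l))"
        then obtain m y where y: "y \<in> (K \<inter> ?Ei) \<inter> ?E l" "x = (T i ^^ k) (?F l m y)"
          by blast
        \<comment> \<open>As \<open>i\<close> is not in \<open>l\<close>, its exponent is free and
          can absorb the power \<open>k\<close>.\<close>
        have "?F l m = ?F l (m(i := k))"
          using i(2) by (intro funpow_list_cong) (auto simp: index_mult_def)
        then have "x = ?F (i # l) (m(i := k)) y"
          using y(2) True by (simp add: index_mult_def)
        moreover have "y \<in> K \<inter> ?E (i # l)"
          using y(1) unfolding set by auto
        ultimately show "x \<in> (\<Union>m. ?F (i # l) m ` (K \<inter> ?E (i # l)))"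
          by blast
      qed
      finally show "(T i ^^ k) ` ((K \<inter> ?B l) \<inter> ?Ei) \<subseteq> ?G" .
    qed
    finally show ?thesis .
  qed
qed

text \<open>One inclusion uses only the exponent zero and exponents supported at one index. For the
  other, each \<open>T i\<close> with \<alpha> equal to 0 at \<open>i\<close> maps the right-hand
  side onto itself, so every product of such operators does.\<close>

lemma joint_wandering_space_eq:
  "(\<Inter>k\<in>multi_indices n.
      multi_power n T (index_mult (index_complement \<alpha>) k) ` wandering_space n T \<alpha>) =
    (\<Inter>i\<in>{i\<in>{1..n}. \<alpha> i = 0}. H_infinity (T i)) \<inter> wandering_space n T \<alpha>"
    (is "?D = ?N \<inter> ?E")
proof (intro Int_greatest equalityI INT_greatest)
  let ?P = "\<lambda>k. multi_power n T (index_mult (index_complement \<alpha>) k)"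
  have restrict: "restrict k {1..n} \<in> multi_indices n" for k
    by (simp add: multi_indices_def)
  have id: "?P (\<lambda>_\<in>{1..n}. 0) = id"
    unfolding multi_power_eq by (rule funpow_list_id) (auto simp: index_mult_def)
  show "?D \<subseteq> ?E"
    using INT_lower[OF restrict[of "\<lambda>_. 0"], of "\<lambda>k. ?P k ` ?E"] unfolding id image_id id_apply .
  fix i assume i: "i \<in> {i\<in>{1..n}. \<alpha> i = 0}"
  show "?D \<subseteq> H_infinity (T i)"
  proof
    fix x assume x: "x \<in> ?D"
    have "x \<in> range (T i ^^ m)" for m
    proof -
      \<comment> \<open>All exponents but the one at \<open>i\<close> vanish, so the product reduces
        to a power of \<open>T i\<close>.\<close>
      let ?k = "\<lambda>j\<in>{1..n}. if j = i then m else 0"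
      have "?P ?k = T i ^^ index_mult (index_complement \<alpha>) ?k i"
        unfolding multi_power_eq
        by (rule funpow_list_single) (use i in \<open>auto simp: index_mult_def\<close>)
      also have "index_mult (index_complement \<alpha>) ?k i = m"
        using i by (simp add: index_mult_def index_complement_def)
      finally have eq: "?P ?k = T i ^^ m" .
      have "x \<in> ?P ?k ` ?E"
        using x restrict by (rule INT_D)
      then show ?thesis
        unfolding eq by (rule subsetD[OF image_mono[OF subset_UNIV]])
    qed
    then show "x \<in> H_infinity (T i)"
      unfolding H_infinity_iff by (rule allI)
  qed
next
  fix k
  \<comment> \<open>The preimage of \<open>x\<close> is \<open>cadjoint (T i) x\<close>:
    \<open>T i\<close> is unitary on \<open>H_infinity (T i)\<close>, and its adjoint preserves the
    other spaces because they reduce \<open>T i\<close>.\<close>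
  have surj: "?N \<inter> ?E \<subseteq> T i ` (?N \<inter> ?E)" if i: "i \<in> {1..n}" "\<alpha> i = 0" for i
  proof
    fix x assume x: "x \<in> ?N \<inter> ?E"
    have "x \<in> H_infinity (T i)"
      using x i by auto
    moreover have "unitary_on (H_infinity (T i)) (T i)"
      using wold[OF i(1)] by (simp add: wold_type_decomposition_def)
    ultimately have "x = T i (cadjoint (T i) x)"
      by (rule sym[OF unitary_on_cadjoint(2)[OF bounded_clinear_T[OF i(1)] _
            reducing_H_infinity_T[OF i(1) i(1)]], rotated])
    moreover have "cadjoint (T i) x \<in> H_infinity (T j)" if "j \<in> {1..n}" "\<alpha> j = 0" for j
    proof -
      have "x \<in> H_infinity (T j)"
        using x that by blast
      then show ?thesis
        using reducing_H_infinity_T[OF i(1) that(1)] unfolding reducing_def by blast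
    qed
    then have "cadjoint (T i) x \<in> ?N"
      by blast
    moreover have "cadjoint (T j) (cadjoint (T i) x) = 0" if "j \<in> {1..n}" "\<alpha> j = 1" for j
    proof -
      have "cadjoint (T j) x = 0"
        using x that unfolding wandering_space_def by blast
      moreover have "i \<noteq> j"
        using i(2) that(2) by auto
      ultimately show ?thesis
        using reducing_ker_T[OF i(1) that(1)] unfolding reducing_def by blast
    qed
    then have "cadjoint (T i) x \<in> ?E"
      by (simp add: wandering_space_def)
    ultimately show "x \<in> T i ` (?N \<inter> ?E)"
      by (intro rev_image_eqI[of "cadjoint (T i) x"] IntI)
  qed
  have "?N \<inter> ?E \<subseteq> multi_power n T (index_mult (index_complement \<alpha>) k) ` (?N \<inter> ?E)"
    unfolding multi_power_eq
  proof (rule funpow_list_surj)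
    fix i assume "i \<in> set [1..<Suc n]" "index_mult (index_complement \<alpha>) k i \<noteq> 0"
    \<comment> \<open>Truncated subtraction makes \<open>1 - \<alpha> i\<close> nonzero only when
      \<open>\<alpha> i = 0\<close>.\<close>
    then have "i \<in> {1..n}" "\<alpha> i = 0"
      by (auto simp: index_mult_def index_complement_def)
    then show "?N \<inter> ?E \<subseteq> T i ` (?N \<inter> ?E)"
      by (rule surj)
  qed
  then show "?N \<inter> ?E \<subseteq> multi_power n T (index_mult (index_complement \<alpha>) k) ` ?E"
    by blast
qed

text \<open>The generators lie in the joint summand, which is closed and invariant under all
  \<open>T i\<close>. Conversely, the joint summand is \<open>?N\<close> cut down by the complements
  at indices with value 1, and peeling these off shows that it is generated by the wandering vectors
  in \<open>?N\<close>.\<close>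

lemma wold_component_eq:
  assumes "\<alpha> \<in> binary_indices n"
  shows "wold_component n T \<alpha> = joint_summand \<alpha>"
proof
  let ?N = "\<Inter>i\<in>{i\<in>{1..n}. \<alpha> i = 0}. H_infinity (T i)"
  have \<alpha>: "\<alpha> i \<in> {0, 1}" if "i \<in> {1..n}" for i
    using assms that unfolding binary_indices_def by (rule PiE_mem)
  have l: "set [1..<Suc n] = {1..n}"
    by auto
  have inv: "T i ` joint_summand \<alpha> \<subseteq> joint_summand \<alpha>" if "i \<in> set [1..<Suc n]" for i
    using reducing_joint_summand[of i \<alpha>] that unfolding l reducing_def by blast
  have comp: "wold_component n T \<alpha> = closed_cspan (\<Union>m\<in>multi_indices n.
      multi_power n T (index_mult \<alpha> m) ` (?N \<inter> wandering_space n T \<alpha>))"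
    by (simp only: wold_component_def joint_wandering_space_eq)
  have wandering: "?N \<inter> wandering_space n T \<alpha> \<subseteq> joint_summand \<alpha>"
    unfolding joint_summand_def
  proof (intro INT_greatest)
    fix i assume i: "i \<in> {1..n}"
    show "?N \<inter> wandering_space n T \<alpha> \<subseteq> wold_summand i (\<alpha> i)"
    proof (cases "\<alpha> i = 0")
      case True
      with i have "i \<in> {i\<in>{1..n}. \<alpha> i = 0}"
        by simp
      then have "?N \<subseteq> H_infinity (T i)"
        by (rule INT_lower)
      then have "?N \<subseteq> wold_summand i (\<alpha> i)"
        by (simp only: wold_summand_def True refl if_True)
      then show ?thesis
        by (rule le_infI1)
    next
      case False
      then have "\<alpha> i = 1"
        using \<alpha>[OF i] by simp
      then have "wandering_space n T \<alpha> \<subseteq> {x. cadjoint (T i) x = 0}"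
        using i unfolding wandering_space_def by blast
      also have "\<dots> \<subseteq> wold_summand i (\<alpha> i)"
        using ker_cadjoint_subset_orth_H_infinity[OF wold[OF i]] False
        by (simp only: wold_summand_def if_False)
      finally show ?thesis
        by (rule le_infI2)
    qed
  qed
  have power: "multi_power n T k ` (?N \<inter> wandering_space n T \<alpha>) \<subseteq> joint_summand \<alpha>" for k
  proof (rule image_subsetI)
    fix x assume "x \<in> ?N \<inter> wandering_space n T \<alpha>"
    with wandering have "x \<in> joint_summand \<alpha>"
      by (rule subsetD)
    then show "multi_power n T k x \<in> joint_summand \<alpha>"
      unfolding multi_power_eq by (intro funpow_list_invariant inv)
  qed
  show "wold_component n T \<alpha> \<subseteq> joint_summand \<alpha>"
    unfolding comp by (intro closed_cspan_minimal closed_csubspace_joint_summand UN_least power)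
  have "joint_summand \<alpha> \<subseteq> ?N \<inter> (\<Inter>i\<in>{i\<in>set [1..<Suc n]. \<alpha> i = 1}. orth (H_infinity (T i)))"
    unfolding l
  proof (intro Int_greatest INT_greatest)
    show "joint_summand \<alpha> \<subseteq> H_infinity (T i)" if "i \<in> {i\<in>{1..n}. \<alpha> i = 0}" for i
      using joint_summand_subset[of i \<alpha>] that by (simp add: wold_summand_def)
    show "joint_summand \<alpha> \<subseteq> orth (H_infinity (T i))" if "i \<in> {i\<in>{1..n}. \<alpha> i = 1}" for i
      using joint_summand_subset[of i \<alpha>] that by (simp add: wold_summand_def)
  qed
  \<comment> \<open>The peeling result is used with \<open>K\<close> equal to \<open>?N\<close>,
    which reduces all the operators.\<close>
  also have "\<dots> \<subseteq> closed_cspan (\<Union>m. funpow_list T (index_mult \<alpha> m) [1..<Suc n] `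
      (?N \<inter> (\<Inter>i\<in>{i\<in>set [1..<Suc n]. \<alpha> i = 1}. {x. cadjoint (T i) x = 0})))"
  proof (intro reducing_Int_joint_shift_span_subset closed_csubspace_INT reducing_INT
      reducing_H_infinity_T)
    show "closed_csubspace (H_infinity (T i))" if "i \<in> {i\<in>{1..n}. \<alpha> i = 0}" for i
      using closed_csubspace_wold_summand[of i 0] that by (simp add: wold_summand_def)
    show "\<alpha> i \<in> {0, 1}" if "i \<in> set [1..<Suc n]" for i
      using \<alpha> that unfolding l .
  qed auto
  also have "\<dots> \<subseteq> wold_component n T \<alpha>"
    unfolding comp
  proof (intro closed_cspan_mono UN_least)
    fix m
    \<comment> \<open>Exponents outside \<open>{1..n}\<close> do not enter the product, so an
      arbitrary \<open>m\<close> may be replaced by a member of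
      \<open>multi_indices n\<close>.\<close>
    have m: "funpow_list T (index_mult \<alpha> m) [1..<Suc n] =
        multi_power n T (index_mult \<alpha> (restrict m {1..n}))"
      unfolding multi_power_eq by (rule funpow_list_cong) (auto simp: index_mult_def)
    have restrict: "restrict m {1..n} \<in> multi_indices n"
      by (simp add: multi_indices_def)
    have E: "(\<Inter>i\<in>{i\<in>set [1..<Suc n]. \<alpha> i = 1}. {x. cadjoint (T i) x = 0}) =
        wandering_space n T \<alpha>"
      unfolding l wandering_space_def by blast
    show "funpow_list T (index_mult \<alpha> m) [1..<Suc n] `
        (?N \<inter> (\<Inter>i\<in>{i\<in>set [1..<Suc n]. \<alpha> i = 1}. {x. cadjoint (T i) x = 0})) \<subseteq>
        (\<Union>m\<in>multi_indices n.
          multi_power n T (index_mult \<alpha> m) ` (?N \<inter> wandering_space n T \<alpha>))"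
      unfolding m E by (rule UN_upper[OF restrict])
  qed
  finally show "joint_summand \<alpha> \<subseteq> wold_component n T \<alpha>" .
qed

end

theorem theorem2p14:
  fixes T :: "nat \<Rightarrow> 'a::chilbert_space \<Rightarrow> 'a" and n :: nat
  assumes "separable_space (euclidean :: 'a topology)"
    and "left_inverse_commuting n T"
    and "\<And>i. i \<in> {1..n} \<Longrightarrow> wold_type_decomposition (T i)"
  shows "orthogonal_direct_sum (binary_indices n) (wold_component n T) \<and>
    (\<forall>\<alpha>\<in>binary_indices n. \<forall>i\<in>{1..n}.
       reducing (T i) (wold_component n T \<alpha>) \<and>
       (\<alpha> i = 0 \<longrightarrow> unitary_on (wold_component n T \<alpha>) (T i)))"
proof (intro conjI ballI impI)
  have eq: "wold_component n T \<alpha> = joint_summand T n \<alpha>" if "\<alpha> \<in> binary_indices n" for \<alpha>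
    using assms(2,3) that by (rule wold_component_eq)
  show "orthogonal_direct_sum (binary_indices n) (wold_component n T)"
    using orthogonal_direct_sum_joint_summand[OF assms(2,3)] eq
    by (rule orthogonal_direct_sum_eq_on)
  fix \<alpha> i assume "\<alpha> \<in> binary_indices n" and i: "i \<in> {1..n}"
  then have "wold_component n T \<alpha> = joint_summand T n \<alpha>"
    by (intro eq)
  then show "reducing (T i) (wold_component n T \<alpha>)"
    and "\<alpha> i = 0 \<Longrightarrow> unitary_on (wold_component n T \<alpha>) (T i)"
    using reducing_joint_summand[OF assms(2,3) i] unitary_on_joint_summand[OF assms(2,3) i]
    by simp_all
qed

end
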